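(* Let $P$ and $Q$ be Borel probability measures on a Polish space $\Omega$ with $Q \ll P$, and let $K$ be the index returned by a causal rejection sampler with proposal $P$ and target $Q$. Then $$\mathbb{E}[K] \ge 2^{D_\infty[Q\|P]}.$$
   Context: A causal rejection sampler with proposal $P$ and target $Q$ consists of a sequence $(X_i)_{i\ge 1}$ of i.i.d. random variables with $X_i\sim P$, together with a finite stopping time $K\in\{1,2,\dots\}$ adapted to the sequence (i.e. $\{K\le k\}\in\sigma(X_1,\dots,X_k)$ for every $k$), such that $X_K\sim Q$. The index returned is $K$. The Rényi $\infty$-divergence is $D_\infty[Q\|P]=\operatorname{ess\,sup}_{x\in\Omega}\log_2\frac{dQ}{dP}(x)$, the essential supremum being taken with respect to $P$; it may equal $+\infty$, with $2^{+\infty}=+\infty$. *)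

theory Defs
  imports "HOL-Probability.Probability" "HOL-Probability.Essential_Supremum"
begin

definition natural_filtration :: "'w measure \<Rightarrow> (nat \<Rightarrow> 'w \<Rightarrow> 'a::topological_space) \<Rightarrow> nat \<Rightarrow> 'w measure"
  where "natural_filtration M X k =
    sigma (space M) (\<Union>i\<in>{1..k}. {X i -` A \<inter> space M |A. A \<in> sets borel})"

text \<open>The samples are indexed from 1, so \<^term>\<open>X 0\<close> is a dummy on which nothing depends.
  Measurability of the samples is part of the independence assumption; measurability of
  \<^term>\<open>K\<close> follows from it being a stopping time.\<close>

locale causal_rejection_sampler = prob_space M
  for M :: "'w measure" +
  fixes X :: "nat \<Rightarrow> 'w \<Rightarrow> 'a::polish_space"
    and K :: "'w \<Rightarrow> nat"
    and P Q :: "'a measure"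
  assumes indep: "indep_vars (\<lambda>_. borel) X {1..}"
    and proposal: "\<And>i. i \<ge> 1 \<Longrightarrow> distr M borel (X i) = P"
    and index_pos: "\<And>\<omega>. \<omega> \<in> space M \<Longrightarrow> K \<omega> \<ge> 1"
    and stopping: "stopping_time (natural_filtration M X) K"
    and target: "distr M borel (\<lambda>\<omega>. X (K \<omega>) \<omega>) = Q"

definition log2_ennreal :: "ennreal \<Rightarrow> ereal"
  where "log2_ennreal x =
    (if x = 0 then -\<infinity> else if x = \<infinity> then \<infinity> else ereal (log 2 (enn2real x)))"

definition exp2_ereal :: "ereal \<Rightarrow> ennreal"
  where "exp2_ereal x =
    (if x = -\<infinity> then 0 else if x = \<infinity> then \<infinity> else ennreal (2 powr real_of_ereal x))"

text \<open>The library's \<^term>\<open>esssup\<close> is \<^term>\<open>top\<close> on non-measurable functions; the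
  following lemma shows that this case does not arise below.\<close>

lemma measurable_log2_ennreal [measurable]: "log2_ennreal \<in> borel_measurable borel"
  unfolding log2_ennreal_def by measurable

definition Renyi_infinity_divergence :: "'a measure \<Rightarrow> 'a measure \<Rightarrow> ereal"
  where "Renyi_infinity_divergence Q P = esssup P (\<lambda>x. log2_ennreal (RN_deriv P Q x))"

end

theory Submission
  imports Defs
begin

text \<open>For measurable \<open>A\<close>, \<open>Q A\<close> is the sum over \<open>t\<close> of \<open>Pr (K = t + 1, X (t + 1) \<in> A)\<close>.
  Relaxing \<open>K = t + 1\<close> to \<open>K > t\<close>, an event determined by the first \<open>t\<close> samples and hence
  independent of sample \<open>t + 1\<close>, bounds this by the sum of \<open>Pr (K > t) * P A\<close>, which is
  \<open>E[K] * P A\<close>. So \<open>E[K]\<close> dominates the density of \<open>Q\<close> almost everywhere.\<close>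

lemma mono_log2_ennreal: "mono log2_ennreal"
proof
  fix x y :: ennreal
  assume xy: "x \<le> y"
  show "log2_ennreal x \<le> log2_ennreal y"
  proof (cases "x = 0 \<or> y = \<infinity>")
    case True
    then show ?thesis using xy by (auto simp: log2_ennreal_def)
  next
    case False
    then have "x \<noteq> \<infinity>" "y \<noteq> 0" using xy by (auto simp: top_unique)
    moreover have "0 < enn2real x" "enn2real x \<le> enn2real y"
      using False xy by (auto simp: enn2real_positive_iff less_top zero_less_iff_neq_zero
          intro: enn2real_mono le_less_trans)
    ultimately show ?thesis using False by (simp add: log2_ennreal_def)
  qed
qed

lemma mono_exp2_ereal: "mono exp2_ereal"
proof
  fix x y :: ereal
  assume "x \<le> y"
  then show "exp2_ereal x \<le> exp2_ereal y"
    by (cases x; cases y) (auto simp: exp2_ereal_def intro: ennreal_leI)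
qed

text \<open>The conventions at 0 and infinity match, so a bound on the log-density can be
  exponentiated without loss.\<close>

lemma exp2_log2_ennreal: "exp2_ereal (log2_ennreal x) = x"
proof (cases "x = 0 \<or> x = \<infinity>")
  case True
  then show ?thesis by (auto simp: exp2_ereal_def log2_ennreal_def)
next
  case False
  then have "0 < enn2real x" "x < top"
    by (auto simp: enn2real_positive_iff less_top zero_less_iff_neq_zero)
  then show ?thesis
    using False by (simp add: exp2_ereal_def log2_ennreal_def)
qed

text \<open>Were the density above \<open>c\<close> on a set \<open>A\<close> of positive measure,
  integrating it over \<open>A\<close> would give \<open>N\<close> strictly more than
  \<open>c * emeasure M A\<close>.\<close>

lemma (in sigma_finite_measure) RN_deriv_AE_le:
  assumes ac: "absolutely_continuous M N" and sets: "sets N = sets M"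
    and fin: "emeasure M (space M) \<noteq> \<infinity>"
    and le: "\<And>A. A \<in> sets M \<Longrightarrow> emeasure N A \<le> c * emeasure M A"
  shows "AE x in M. RN_deriv M N x \<le> c"
proof (cases "c = \<infinity>")
  case True
  then show ?thesis by simp
next
  case False
  define A where "A = {x \<in> space M. c < RN_deriv M N x}"
  have A [measurable]: "A \<in> sets M"
    unfolding A_def by measurable
  have int: "(\<integral>\<^sup>+x. c * indicator A x \<partial>M) = c * emeasure M A"
    by (rule nn_integral_cmult_indicator[OF A])
  \<comment> \<open>The strict comparison of integrals below needs the smaller one to be
    finite.\<close>
  have "emeasure M A \<noteq> \<infinity>"
    using fin emeasure_space[of M A] by (auto simp: top_unique)
  then have int_fin: "(\<integral>\<^sup>+x. c * indicator A x \<partial>M) \<noteq> \<infinity>"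
    using False by (auto simp: int ennreal_mult_eq_top_iff)
  \<comment> \<open>The inequality fails at every point of \<open>A\<close> and holds off
    \<open>A\<close>, so this says that \<open>A\<close> is null.\<close>
  have "AE x in M. RN_deriv M N x * indicator A x \<le> c * indicator A x"
  proof (rule ccontr)
    assume neg: "\<not> ?thesis"
    have "(\<integral>\<^sup>+x. c * indicator A x \<partial>M) < (\<integral>\<^sup>+x. RN_deriv M N x * indicator A x \<partial>M)"
      by (rule nn_integral_less[OF _ _ int_fin _ neg]) (auto simp: A_def split: split_indicator)
    also have "\<dots> = emeasure (density M (RN_deriv M N)) A"
      by (simp add: emeasure_density)
    also have "\<dots> = emeasure N A"
      by (simp add: density_RN_deriv[OF ac sets])
    finally show False
      using le[OF A] by (simp add: int)
  qed
  then show ?thesis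
    using AE_space by eventually_elim (auto simp: A_def not_less[symmetric])
qed

context causal_rejection_sampler
begin

lemma sample_measurable [measurable]: "i \<ge> 1 \<Longrightarrow> X i \<in> borel_measurable M"
  using indep by (auto simp: indep_vars_def2)

lemma space_natural_filtration: "space (natural_filtration M X k) = space M"
  unfolding natural_filtration_def by (rule space_measure_of) auto

lemma sets_natural_filtration:
  "sets (natural_filtration M X k) =
    sigma_sets (space M) (\<Union>i\<in>{1..k}. {X i -` A \<inter> space M |A. A \<in> sets borel})"
  unfolding natural_filtration_def by (rule sets_measure_of) auto

lemma natural_filtration_subset: "sets (natural_filtration M X k) \<subseteq> events"
  unfolding sets_natural_filtration
  by (rule sets.sigma_sets_subset) (auto intro!: measurable_sets[OF sample_measurable])

lemma index_measurable [measurable]: "K \<in> M \<rightarrow>\<^sub>M count_space UNIV"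
proof -
  have "K \<in> borel_measurable M"
    using stopping natural_filtration_subset space_natural_filtration
    by (rule measurable_stopping_time)
  then show ?thesis
    by (simp add: measurable_cong_sets[OF refl sets_borel_eq_count_space])
qed

text \<open>The complement \<open>K \<le> t\<close> is decided by the first \<open>t\<close>
  samples; sample \<open>Suc t\<close> is not consulted.\<close>

lemma index_greater_event: "{\<omega> \<in> space M. t < K \<omega>} \<in> sets (natural_filtration M X t)"
  using stopping_timeD2[OF stopping, of t]
  by (simp add: Measurable.pred_def space_natural_filtration)

text \<open>Disjoint blocks of an independent family generate independent sigma-algebras.\<close>

lemma natural_filtration_indep_next:
  assumes E: "E \<in> sets (natural_filtration M X t)" and A: "A \<in> sets borel"
  shows "prob (E \<inter> (X (Suc t) -` A \<inter> space M)) = prob E * prob (X (Suc t) -` A \<inter> space M)"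
proof -
  let ?F = "\<lambda>i. {X i -` A \<inter> space M |A. A \<in> sets borel}"
  \<comment> \<open>\<open>True\<close> labels the past and \<open>False\<close> the next sample; at
    \<open>t = 0\<close> the past is empty and its sigma-algebra trivial.\<close>
  let ?I = "\<lambda>b. if b then {1..t} else {Suc t}"
  let ?S = "\<lambda>b. sigma_sets (space M) (\<Union>i\<in>?I b. ?F i)"
  have "indep_sets ?S UNIV"
  proof (rule indep_sets_collect_sigma)
    have "indep_sets ?F {1..}"
      using indep by (auto simp: indep_vars_def2)
    then show "indep_sets ?F (\<Union>b\<in>UNIV. ?I b)"
      by (rule indep_sets_mono_index[rotated]) (auto split: if_splits)
  next
    fix i
    \<comment> \<open>Independence passes from generators to sigma-algebras only when the generators
      are closed under intersection.\<close>
    have "X i -` B \<inter> space M \<inter> (X i -` C \<inter> space M) \<in> ?F i"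
      if "B \<in> sets borel" "C \<in> sets borel" for B C
      using that by (intro CollectI exI[of _ "B \<inter> C"]) auto
    then show "Int_stable (?F i)"
      unfolding Int_stable_def by blast
  qed (auto simp: disjoint_family_on_def)
  from indep_setsD[OF this, of UNIV "\<lambda>b. if b then E else X (Suc t) -` A \<inter> space M"] show ?thesis
    using E A unfolding sets_natural_filtration UNIV_bool by (auto simp: ac_simps)
qed

lemma selected_sample_measurable: "(\<lambda>\<omega>. X (K \<omega>) \<omega>) \<in> borel_measurable M"
proof (rule measurableI)
  fix A :: "'a set" assume [measurable]: "A \<in> sets borel"
  \<comment> \<open>Splitting by the value of \<open>K\<close> leaves countably many fixed indices,
    all positive, where the samples are known to be measurable.\<close>
  have "(\<lambda>\<omega>. X (K \<omega>) \<omega>) -` A \<inter> space M =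
      (\<Union>t. {\<omega> \<in> space M. K \<omega> = Suc t} \<inter> (X (Suc t) -` A \<inter> space M))"
    using index_pos by (force simp: gr0_conv_Suc Suc_le_eq)
  also have "\<dots> \<in> events"
    by measurable
  finally show "(\<lambda>\<omega>. X (K \<omega>) \<omega>) -` A \<inter> space M \<in> events" .
qed simp

lemma target_le_expected_index_times_proposal:
  assumes A [measurable]: "A \<in> sets borel"
  shows "emeasure Q A \<le> (\<integral>\<^sup>+ \<omega>. of_nat (K \<omega>) \<partial>M) * emeasure P A"
proof -
  let ?E = "\<lambda>t. {\<omega> \<in> space M. t < K \<omega>}" and ?S = "\<lambda>t. X (Suc t) -` A \<inter> space M"
  have E [measurable]: "?E t \<in> events" for t
    by measurable
  have S [measurable]: "?S t \<in> events" for t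
    by measurable
  have S_prob: "emeasure M (?S t) = emeasure P A" for t
    using proposal[of "Suc t"] by (auto simp: emeasure_distr)
  have "emeasure Q A = emeasure M ((\<lambda>\<omega>. X (K \<omega>) \<omega>) -` A \<inter> space M)"
    unfolding target[symmetric] using selected_sample_measurable A by (rule emeasure_distr)
  also have "\<dots> \<le> emeasure M (\<Union>t. ?E t \<inter> ?S t)"
  proof (rule emeasure_mono)
    show "(\<lambda>\<omega>. X (K \<omega>) \<omega>) -` A \<inter> space M \<subseteq> (\<Union>t. ?E t \<inter> ?S t)"
    proof
      fix \<omega> assume "\<omega> \<in> (\<lambda>\<omega>. X (K \<omega>) \<omega>) -` A \<inter> space M"
      \<comment> \<open>The witness \<open>t\<close> is \<open>K \<omega> - 1\<close>, the number of
        samples drawn before the returned one.\<close>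
      moreover from this obtain t where "K \<omega> = Suc t"
        using index_pos[of \<omega>] by (cases "K \<omega>") auto
      ultimately show "\<omega> \<in> (\<Union>t. ?E t \<inter> ?S t)"
        by (auto intro!: exI[of _ t])
    qed
  qed measurable
  \<comment> \<open>The events \<open>?E t\<close> are nested rather than disjoint, hence
    subadditivity.\<close>
  also have "\<dots> \<le> (\<Sum>t. emeasure M (?E t \<inter> ?S t))"
    by (rule emeasure_subadditive_countably) auto
  also have "\<dots> = (\<Sum>t. emeasure M (?E t) * emeasure P A)"
  proof (rule arg_cong[where f = suminf], rule ext)
    fix t
    show "emeasure M (?E t \<inter> ?S t) = emeasure M (?E t) * emeasure P A"
      unfolding S_prob[of t, symmetric] emeasure_eq_measure
        natural_filtration_indep_next[OF index_greater_event A]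
      by (simp add: ennreal_mult)
  qed
  \<comment> \<open>Tail-sum formula: E[K] is the sum of Pr (K > t) over all t \<ge> 0, possibly
    infinite.\<close>
  also have "\<dots> = (\<integral>\<^sup>+ \<omega>. of_nat (K \<omega>) \<partial>M) * emeasure P A"
    by (simp add: nn_integral_nat_function)
  finally show ?thesis .
qed

end

theorem mainTheorem1:
  fixes P Q :: "'a::polish_space measure"
    and M :: "'w measure"
    and X :: "nat \<Rightarrow> 'w \<Rightarrow> 'a"
    and K :: "'w \<Rightarrow> nat"
  assumes "prob_space P" and "sets P = sets borel"
    and "prob_space Q" and "sets Q = sets borel"
    and "absolutely_continuous P Q"
    and "causal_rejection_sampler M X K P Q"
  shows "(\<integral>\<^sup>+ \<omega>. of_nat (K \<omega>) \<partial>M) \<ge> exp2_ereal (Renyi_infinity_divergence Q P)"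
proof -
  interpret P: prob_space P by fact
  interpret causal_rejection_sampler M X K P Q by fact
  let ?c = "\<integral>\<^sup>+ \<omega>. of_nat (K \<omega>) \<partial>M"
  have "AE x in P. RN_deriv P Q x \<le> ?c"
    using assms target_le_expected_index_times_proposal by (intro P.RN_deriv_AE_le) auto
  then have "AE x in P. log2_ennreal (RN_deriv P Q x) \<le> log2_ennreal ?c"
    by eventually_elim (rule monoD[OF mono_log2_ennreal])
  \<comment> \<open>A constant that dominates a measurable function almost everywhere dominates its
    essential supremum.\<close>
  then have "Renyi_infinity_divergence Q P \<le> log2_ennreal ?c"
    unfolding Renyi_infinity_divergence_def by (intro esssup_I) measurable
  from monoD[OF mono_exp2_ereal this] show ?thesis
    by (simp only: exp2_log2_ennreal)
qed

end
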